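(* Let $P$ be a non-negative $n\times m$ real matrix, without zero columns, such that $\mathrm{rk}(P)>1$. For any $\epsilon>0$ there exists $N_\epsilon\in B(P,\epsilon)$ such that $\mathrm{rk}_+(N_\epsilon)=\mathrm{rk}_+(P)$ and $N_\epsilon\neq\lambda P$ for every $\lambda\in\mathbb{R}$.
   Context: A non-negative $n\times m$ matrix is a real matrix $(p_{i,j})$ with all entries $p_{i,j}\ge 0$; the set of these is denoted $\mathbb{R}^{nm}_{\geq 0}$. $\mathrm{rk}$ denotes the ordinary rank. The non-negative rank $\mathrm{rk}_+(P)$ of a non-negative $n\times m$ matrix $P$ is the smallest integer $k$ such that $P=c_1(r_1)^t+\ldots+c_k(r_k)^t$, where the column vectors $c_h\in\mathbb{R}^n$ and $r_h\in\mathbb{R}^m$ have non-negative entries. For a non-negative matrix $P=(p_{i,j})$ and $\epsilon>0$, the ball of center $P$ and radius $\epsilon$ (with respect to the Frobenius norm, inside the non-negative matrices) is $$B(P,\epsilon)=\left\{N=(n_{i,j})\in\mathbb{R}^{nm}_{\geq 0} : \sqrt{\sum_{i,j} (p_{i,j}-n_{i,j})^2}<\epsilon\right\}.$$ *)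

theory Defs
  imports "HOL-Analysis.Analysis"
begin

text \<open>
  An \<open>n \<times> m\<close> matrix is an element of \<^typ>\<open>real ^ 'm ^ 'n\<close> (\<open>'n\<close> indexes rows, \<open>'m\<close> columns).
\<close>

definition nonneg_matrix :: "real ^ 'm ^ 'n \<Rightarrow> bool" where
  "nonneg_matrix P \<longleftrightarrow> (\<forall>i j. P $ i $ j \<ge> 0)"

definition nonneg_vector :: "real ^ 'n \<Rightarrow> bool" where
  "nonneg_vector v \<longleftrightarrow> (\<forall>i. v $ i \<ge> 0)"

definition outer_product :: "real ^ 'n \<Rightarrow> real ^ 'm \<Rightarrow> real ^ 'm ^ 'n" where
  "outer_product c r = (\<chi> i j. c $ i * r $ j)"

text \<open>
  Only meaningful for non-negative \<open>P\<close>, for which a decomposition always exists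
  (e.g. one term per column); otherwise the set of admissible \<open>k\<close> is empty.
\<close>

definition nonneg_rank :: "real ^ 'm ^ 'n \<Rightarrow> nat" where
  "nonneg_rank P = (LEAST k. \<exists>(c :: nat \<Rightarrow> real ^ 'n) (r :: nat \<Rightarrow> real ^ 'm).
     (\<forall>h<k. nonneg_vector (c h) \<and> nonneg_vector (r h)) \<and>
     P = (\<Sum>h<k. outer_product (c h) (r h)))"

definition nonneg_ball :: "real ^ 'm ^ 'n \<Rightarrow> real \<Rightarrow> (real ^ 'm ^ 'n) set" where
  "nonneg_ball P \<epsilon> =
     {N. nonneg_matrix N \<and> sqrt (\<Sum>i\<in>UNIV. \<Sum>j\<in>UNIV. (P $ i $ j - N $ i $ j)\<^sup>2) < \<epsilon>}"

end

theory Submission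
  imports Defs
begin

text \<open>
  Multiplying the columns of \<open>P\<close> by positive factors does not change the non-negative rank: the
  factors can be absorbed into the row vectors of a non-negative decomposition, and the inverse
  factors undo the change (\<open>nonneg_rank_scale_columns\<close>). So it suffices to multiply a single
  column by \<open>1 + t\<close> for a small \<open>t > 0\<close>. Since \<open>rk(P) > 1\<close> there is a second column; it is
  non-zero and left fixed, so the new matrix could only be \<open>1 \<cdot> P\<close>, which the rescaled non-zero
  column rules out.
\<close>

definition scale_columns :: "real ^ 'm \<Rightarrow> real ^ 'm ^ 'n \<Rightarrow> real ^ 'm ^ 'n" where
  "scale_columns d P = (\<chi> i j. d $ j * P $ i $ j)"

definition nonneg_decomposable :: "nat \<Rightarrow> real ^ 'm ^ 'n \<Rightarrow> bool" where
  "nonneg_decomposable k P \<longleftrightarrow> (\<exists>(c :: nat \<Rightarrow> real ^ 'n) (r :: nat \<Rightarrow> real ^ 'm).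
     (\<forall>h<k. nonneg_vector (c h) \<and> nonneg_vector (r h)) \<and>
     P = (\<Sum>h<k. outer_product (c h) (r h)))"

lemma nonneg_rank_eq_Least: "nonneg_rank P = (LEAST k. nonneg_decomposable k P)"
  unfolding nonneg_rank_def nonneg_decomposable_def ..

text \<open>
  The factors are absorbed into the row vectors, so the number of terms stays the same; a zero
  factor does no harm in this direction.
\<close>

lemma nonneg_decomposable_scale_columns:
  fixes d :: "real ^ 'm" and P :: "real ^ 'm ^ 'n"
  assumes d: "\<And>j. d $ j \<ge> 0" and P: "nonneg_decomposable k P"
  shows "nonneg_decomposable k (scale_columns d P)"
proof -
  from P obtain c :: "nat \<Rightarrow> real ^ 'n" and r :: "nat \<Rightarrow> real ^ 'm"
    where nonneg: "\<And>h. h < k \<Longrightarrow> nonneg_vector (c h) \<and> nonneg_vector (r h)"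
      and eq: "P = (\<Sum>h<k. outer_product (c h) (r h))"
    unfolding nonneg_decomposable_def by blast
  let ?r = "\<lambda>h. \<chi> j. d $ j * r h $ j"
  have "\<forall>h<k. nonneg_vector (c h) \<and> nonneg_vector (?r h)"
    using nonneg d by (simp add: nonneg_vector_def)
  moreover have "scale_columns d P = (\<Sum>h<k. outer_product (c h) (?r h))"
    by (simp add: eq scale_columns_def outer_product_def vec_eq_iff sum_distrib_left ac_simps)
  ultimately show ?thesis
    unfolding nonneg_decomposable_def by (intro exI conjI)
qed

lemma nonneg_rank_scale_columns:
  fixes d :: "real ^ 'm" and P :: "real ^ 'm ^ 'n"
  assumes d: "\<And>j. d $ j > 0"
  shows "nonneg_rank (scale_columns d P) = nonneg_rank P"
proof -
  let ?d' = "\<chi> j. inverse (d $ j)"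
  have d': "\<And>j. ?d' $ j \<ge> 0"
    using d by (simp add: less_imp_le)
  have "d $ j \<noteq> 0" for j
    using d[of j] by simp
  then have inv: "scale_columns ?d' (scale_columns d P) = P"
    by (simp add: scale_columns_def vec_eq_iff)
  have "nonneg_decomposable k (scale_columns d P) \<longleftrightarrow> nonneg_decomposable k P" for k
    using nonneg_decomposable_scale_columns[OF less_imp_le[OF d], of k P]
      nonneg_decomposable_scale_columns[OF d', of k "scale_columns d P"]
    unfolding inv by blast
  then show ?thesis
    by (simp add: nonneg_rank_eq_Least)
qed

lemma exists_two_columns_if_rank_gt_1:
  fixes P :: "real ^ 'm ^ 'n"
  assumes "rank P > 1"
  obtains j k :: 'm where "j \<noteq> k"
proof -
  have "card (UNIV :: 'm set) \<noteq> card {j}" for j :: 'm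
    using assms rank_bound[of P] by simp
  then have "(UNIV :: 'm set) \<noteq> {j}" for j
    by metis
  then show ?thesis
    using that by blast
qed

theorem proposition3p2:
  fixes P :: "real ^ 'm ^ 'n" and \<epsilon> :: real
  assumes "nonneg_matrix P"
    and "\<forall>j. column j P \<noteq> 0"
    and "rank P > 1"
    and "\<epsilon> > 0"
  shows "\<exists>N \<in> nonneg_ball P \<epsilon>.
           nonneg_rank N = nonneg_rank P \<and> (\<forall>c :: real. N \<noteq> c *\<^sub>R P)"
proof -
  obtain j k :: 'm where "j \<noteq> k"
    using exists_two_columns_if_rank_gt_1[OF assms(3)] .
  \<comment> \<open>\<open>K\<close> is the norm of column \<open>j\<close>, so the perturbed matrix has distance \<open>t * K\<close> from \<open>P\<close>;
     the \<open>+ 1\<close> makes this strictly less than \<open>\<epsilon>\<close>.\<close>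
  define K where "K = sqrt (\<Sum>i\<in>UNIV. \<Sum>l\<in>UNIV. (if l = j then P $ i $ j else 0)\<^sup>2)"
  define t where "t = \<epsilon> / (K + 1)"
  have "K \<ge> 0"
    by (simp add: K_def sum_nonneg)
  then have t: "t > 0" "t * K < \<epsilon>"
    using \<open>\<epsilon> > 0\<close> by (simp_all add: t_def field_simps)
  define d :: "real ^ 'm" where "d = (\<chi> l. if l = j then 1 + t else 1)"
  have d: "\<And>l. d $ l > 0"
    using t by (simp add: d_def)
  define N where "N = scale_columns d P"
  have "nonneg_matrix N"
    using assms(1) d by (simp add: nonneg_matrix_def N_def scale_columns_def less_imp_le)
  moreover have "sqrt (\<Sum>i\<in>UNIV. \<Sum>l\<in>UNIV. (P $ i $ l - N $ i $ l)\<^sup>2) = t * K"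
  proof -
    have "(P $ i $ l - N $ i $ l)\<^sup>2 = t\<^sup>2 * (if l = j then P $ i $ j else 0)\<^sup>2" for i l
      by (simp add: N_def scale_columns_def d_def power2_eq_square algebra_simps)
    then show ?thesis
      using t by (simp add: K_def real_sqrt_mult flip: sum_distrib_left)
  qed
  ultimately have "N \<in> nonneg_ball P \<epsilon>"
    using t by (simp add: nonneg_ball_def)
  moreover have "nonneg_rank N = nonneg_rank P"
    unfolding N_def using d by (rule nonneg_rank_scale_columns)
  moreover have "N \<noteq> c *\<^sub>R P" for c
  proof
    assume "N = c *\<^sub>R P"
    then have eq: "d $ l * P $ i $ l = c * P $ i $ l" for i l
      by (simp add: N_def scale_columns_def vec_eq_iff)
    have "d $ l = c" for l
    proof -
      obtain i where "P $ i $ l \<noteq> 0"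
        using assms(2) by (auto simp: column_def vec_eq_iff)
      then show ?thesis
        using eq[of l i] by simp
    qed
    then have "d $ j = d $ k"
      by simp
    then show False
      using \<open>j \<noteq> k\<close> t by (simp add: d_def)
  qed
  ultimately show ?thesis
    by blast
qed

end
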